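(* For each $\theta\in[0,1]$, the space $CB(H_{\min},R(\theta))$ of completely bounded maps $H\to H$ coincides with the Hilbert–Schmidt class $\mathfrak{S}_2$ (as sets of operators on $H$), with equivalent norms.
   Context: $H$ is a separable infinite-dimensional Hilbert space with orthonormal basis $(\xi_i)$. $R$ and $C$ are $H$ with matrix norms $\|\sum_i\xi_i\otimes T_i\|_R=\|\sum_iT_iT_i^*\|^{1/2}$ and $\|\sum_i\xi_i\otimes T_i\|_C=\|\sum_iT_i^*T_i\|^{1/2}$ for finite families of matrices $T_i$. For $0<\theta<1$, $R(\theta)=(R,C)_\theta$ is the operator space complex interpolation space, i.e. $M_n(R(\theta))=(M_n(R),M_n(C))_\theta$ (complex interpolation) for each $n$; $R(0)=R$, $R(1)=C$. $H_{\min}$ is $H$ with matrix norms $\|\sum_{i=1}^m\xi_i\otimes T_i\|_{\min}=\sup\{\|\sum_iv_iT_i\|: v\in\ell_2^m,\|v\|=1\}$. For linear $u$ between spaces with matrix norms, $\|u\|_{cb}=\sup_n\|\mathrm{id}_{M_n}\otimes u\|$, and $CB(E,F)$ is the space of $u$ with finite $\|u\|_{cb}$. $\mathfrak{S}_2$ is the Hilbert–Schmidt class with norm $\|x\|_2=(\operatorname{tr}x^*x)^{1/2}$. *)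

theory Defs
  imports "HOL-Analysis.Analysis"
begin

definition l2 :: "(nat \<Rightarrow> complex) set" where
  "l2 = {x. summable (\<lambda>i. (cmod (x i))^2)}"

definition hnorm :: "(nat \<Rightarrow> complex) \<Rightarrow> real" where
  "hnorm x = sqrt (\<Sum>i. (cmod (x i))^2)"

definition basis :: "nat \<Rightarrow> nat \<Rightarrow> complex" where
  "basis j = (\<lambda>i. if i = j then 1 else 0)"

definition is_operator :: "((nat \<Rightarrow> complex) \<Rightarrow> (nat \<Rightarrow> complex)) \<Rightarrow> bool" where
  "is_operator u \<longleftrightarrow> (\<forall>x\<in>l2. u x \<in> l2) \<and>
     (\<forall>x\<in>l2. \<forall>y\<in>l2. \<forall>a b. u (\<lambda>i. a * x i + b * y i) = (\<lambda>i. a * u x i + b * u y i))"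

definition bounded_op :: "((nat \<Rightarrow> complex) \<Rightarrow> (nat \<Rightarrow> complex)) \<Rightarrow> bool" where
  "bounded_op u \<longleftrightarrow> (\<exists>K. \<forall>x\<in>l2. hnorm (u x) \<le> K * hnorm x)"

definition hilbert_schmidt :: "((nat \<Rightarrow> complex) \<Rightarrow> (nat \<Rightarrow> complex)) \<Rightarrow> bool" where
  "hilbert_schmidt u \<longleftrightarrow> is_operator u \<and> bounded_op u \<and>
     summable (\<lambda>j. (hnorm (u (basis j)))^2)"

definition hs_norm :: "((nat \<Rightarrow> complex) \<Rightarrow> (nat \<Rightarrow> complex)) \<Rightarrow> real" where
  "hs_norm u = sqrt (\<Sum>j. (hnorm (u (basis j)))^2)"

text \<open>An n x n complex matrix is a function nat => nat => complex; only entries < n matter.\<close>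
type_synonym cmat = "nat \<Rightarrow> nat \<Rightarrow> complex"

definition opnorm :: "nat \<Rightarrow> cmat \<Rightarrow> real" where
  "opnorm n A = Sup {sqrt (\<Sum>j<n. (cmod (\<Sum>k<n. A j k * v k))^2) | v.
                      (\<Sum>k<n. (cmod (v k))^2) \<le> 1}"

text \<open>An element of M_n(H): an n x n matrix X of vectors of H.  It equals
  sum_i xi_i (x) T_i with (T_i)_{jk} = (X j k) i.\<close>
type_synonym hmat = "nat \<Rightarrow> nat \<Rightarrow> (nat \<Rightarrow> complex)"

definition Mn_l2 :: "nat \<Rightarrow> hmat \<Rightarrow> bool" where
  "Mn_l2 n X \<longleftrightarrow> (\<forall>j<n. \<forall>k<n. X j k \<in> l2)"

definition coef :: "hmat \<Rightarrow> nat \<Rightarrow> cmat" where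
  "coef X i = (\<lambda>j k. X j k i)"

text \<open>Matrix norms; defined for finite families and extended (monotonely) by
  taking the supremum over the truncations to the first m basis vectors.\<close>
definition normR :: "nat \<Rightarrow> hmat \<Rightarrow> ereal" where
  "normR n X = (SUP m. ereal (sqrt (opnorm n
      (\<lambda>j k. \<Sum>i<m. \<Sum>l<n. coef X i j l * cnj (coef X i k l)))))"

definition normC :: "nat \<Rightarrow> hmat \<Rightarrow> ereal" where
  "normC n X = (SUP m. ereal (sqrt (opnorm n
      (\<lambda>j k. \<Sum>i<m. \<Sum>l<n. cnj (coef X i l j) * coef X i l k))))"

definition normMin :: "nat \<Rightarrow> hmat \<Rightarrow> ereal" where
  "normMin n X = (SUP m. ereal (Sup {opnorm n (\<lambda>j k. \<Sum>i<m. v i * coef X i j k) | v.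
                      (\<Sum>i<m. (cmod (v i))^2) \<le> 1}))"

definition hadd :: "hmat \<Rightarrow> hmat \<Rightarrow> hmat" where
  "hadd X Y = (\<lambda>j k i. X j k i + Y j k i)"

definition hsub :: "hmat \<Rightarrow> hmat \<Rightarrow> hmat" where
  "hsub X Y = (\<lambda>j k i. X j k i - Y j k i)"

definition hscale :: "complex \<Rightarrow> hmat \<Rightarrow> hmat" where
  "hscale c X = (\<lambda>j k i. c * X j k i)"

definition normSum :: "nat \<Rightarrow> hmat \<Rightarrow> ereal" where
  "normSum n X = (INF AB \<in> {(A, B). Mn_l2 n A \<and> Mn_l2 n B \<and>
        (\<forall>j<n. \<forall>k<n. X j k = hadd A B j k)}. normR n (fst AB) + normC n (snd AB))"

definition strip :: "complex set" where
  "strip = {z. 0 \<le> Re z \<and> Re z \<le> 1}"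

definition open_strip :: "complex set" where
  "open_strip = {z. 0 < Re z \<and> Re z < 1}"

definition calderon_adm :: "nat \<Rightarrow> real \<Rightarrow> hmat \<Rightarrow> (complex \<Rightarrow> hmat) \<Rightarrow> bool" where
  "calderon_adm n \<theta> X f \<longleftrightarrow>
     (\<forall>z\<in>strip. Mn_l2 n (f z)) \<and>
     (\<exists>B::real. \<forall>z\<in>strip. normSum n (f z) \<le> ereal B) \<and>
     (\<forall>z\<in>strip. ((\<lambda>w. normSum n (hsub (f w) (f z))) \<longlongrightarrow> 0) (at z within strip)) \<and>
     (\<forall>z\<in>open_strip. \<exists>D. Mn_l2 n D \<and>
        ((\<lambda>w. normSum n (hsub (hscale (inverse (w - z)) (hsub (f w) (f z))) D)) \<longlongrightarrow> 0) (at z)) \<and>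
     (\<exists>B::real. \<forall>t::real. normR n (f (\<i> * of_real t)) \<le> ereal B) \<and>
     (\<forall>t::real. ((\<lambda>s::real. normR n (hsub (f (\<i> * of_real s)) (f (\<i> * of_real t)))) \<longlongrightarrow> 0) (at t)) \<and>
     (\<exists>B::real. \<forall>t::real. normC n (f (1 + \<i> * of_real t)) \<le> ereal B) \<and>
     (\<forall>t::real. ((\<lambda>s::real. normC n (hsub (f (1 + \<i> * of_real s)) (f (1 + \<i> * of_real t)))) \<longlongrightarrow> 0) (at t)) \<and>
     (\<forall>j<n. \<forall>k<n. f (of_real \<theta>) j k = X j k)"

definition calderon_norm :: "nat \<Rightarrow> (complex \<Rightarrow> hmat) \<Rightarrow> ereal" where
  "calderon_norm n f = max (SUP t::real. normR n (f (\<i> * of_real t)))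
                           (SUP t::real. normC n (f (1 + \<i> * of_real t)))"

definition normInterp :: "real \<Rightarrow> nat \<Rightarrow> hmat \<Rightarrow> ereal" where
  "normInterp \<theta> n X = (INF f \<in> {f. calderon_adm n \<theta> X f}. calderon_norm n f)"

definition normRtheta :: "real \<Rightarrow> nat \<Rightarrow> hmat \<Rightarrow> ereal" where
  "normRtheta \<theta> n X = (if \<theta> = 0 then normR n X else if \<theta> = 1 then normC n X
                        else normInterp \<theta> n X)"

definition cbnorm :: "real \<Rightarrow> ((nat \<Rightarrow> complex) \<Rightarrow> (nat \<Rightarrow> complex)) \<Rightarrow> ereal" where
  "cbnorm \<theta> u = (SUP n. SUP X \<in> {X. Mn_l2 n X \<and> normMin n X \<le> 1}.
                     normRtheta \<theta> n (\<lambda>j k. u (X j k)))"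

end

(* Upper bound: the i-th coordinate of u applied to X = sum_l xi_l (x) T_l is a combination of the T_l
   with coefficients the i-th row of the matrix of u, so its operator norm is at most the l2-norm of
   that row when X is in the unit ball of M_n(H_min). Hence the row and the column norm of u(X) are both
   bounded by the Hilbert-Schmidt norm of u, and so is the interpolation norm, by a constant
   Calderon function.
   Lower bound: the normalized Hilbert-Schmidt norm (1/n sum_jk |X_jk|^2)^(1/2) is dominated by
   the row and by the column norm, hence by the three lines theorem also by every interpolation norm.
   Testing u on m annihilation operators satisfying the canonical anticommutation relations, which
   span an isometric copy of l2^m inside M_n with normalized Hilbert-Schmidt norm |v| / sqrt 2, gives
   hs_norm u <= sqrt 2 * cbnorm u. *)

theory Submission
  imports Defs "HOL-Complex_Analysis.Complex_Analysis"
begin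

section \<open>Matrices\<close>

text \<open>Entries from \<open>n\<close> on are ignored, so the same function measures vectors of
  C^n and truncations of square-summable sequences.\<close>

definition vnorm :: "nat \<Rightarrow> (nat \<Rightarrow> complex) \<Rightarrow> real" where
  "vnorm n v = L2_set (\<lambda>k. cmod (v k)) {..<n}"

definition mv :: "nat \<Rightarrow> cmat \<Rightarrow> (nat \<Rightarrow> complex) \<Rightarrow> (nat \<Rightarrow> complex)" where
  "mv n A v = (\<lambda>j. \<Sum>k<n. A j k * v k)"

lemma vnorm_nonneg [simp]: "0 \<le> vnorm n v"
  by (simp add: vnorm_def)

lemma vnorm_power2: "(vnorm n v)^2 = (\<Sum>k<n. (cmod (v k))^2)"
  by (simp add: vnorm_def L2_set_def sum_nonneg)

lemma vnorm_zero [simp]: "vnorm n (\<lambda>k. 0) = 0"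
  by (simp add: vnorm_def L2_set_def)

lemma vnorm_le_1_iff: "(\<Sum>k<n. (cmod (v k))^2) \<le> 1 \<longleftrightarrow> vnorm n v \<le> 1"
  by (simp add: vnorm_def L2_set_def)

lemma cmod_le_vnorm: "k < n \<Longrightarrow> cmod (v k) \<le> vnorm n v"
  unfolding vnorm_def by (rule member_le_L2_set) auto

lemma vnorm_scale: "vnorm n (\<lambda>k. c * v k) = cmod c * vnorm n v"
  by (simp add: vnorm_def norm_mult L2_set_right_distrib)

lemma vnorm_eq_0_imp: "vnorm n v = 0 \<Longrightarrow> k < n \<Longrightarrow> v k = 0"
  using cmod_le_vnorm[of k n v] by simp

lemma vnorm_add: "vnorm n (\<lambda>k. v k + w k) \<le> vnorm n v + vnorm n w"
proof -
  have "vnorm n (\<lambda>k. v k + w k) \<le> L2_set (\<lambda>k. cmod (v k) + cmod (w k)) {..<n}"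
    unfolding vnorm_def by (rule L2_set_mono) (auto simp: norm_triangle_ineq)
  also have "\<dots> \<le> vnorm n v + vnorm n w"
    unfolding vnorm_def by (rule L2_set_triangle_ineq)
  finally show ?thesis .
qed

lemma vnorm_sum: "vnorm n (\<lambda>k. \<Sum>i<(m::nat). v i k) \<le> (\<Sum>i<m. vnorm n (v i))"
proof (induction m)
  case (Suc m)
  then show ?case
    using vnorm_add[of n "\<lambda>k. \<Sum>i<m. v i k" "v m"] by simp
qed simp

lemma vnorm_cong: "(\<And>k. k < n \<Longrightarrow> v k = w k) \<Longrightarrow> vnorm n v = vnorm n w"
  by (auto simp: vnorm_def intro!: L2_set_cong)

lemma tendsto_vnorm:
  assumes "\<And>j. j < n \<Longrightarrow> ((\<lambda>N. f N j) \<longlongrightarrow> g j) F"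
  shows "((\<lambda>N. vnorm n (f N)) \<longlongrightarrow> vnorm n g) F"
  unfolding vnorm_def L2_set_def
  using assms by (intro tendsto_intros) auto

section \<open>The operator norm of a matrix\<close>

lemma mv_cong: "(\<And>k. k < n \<Longrightarrow> v k = w k) \<Longrightarrow> mv n A v = mv n A w"
  by (auto simp: mv_def intro!: sum.cong)

lemma mv_scale: "mv n A (\<lambda>k. c * v k) = (\<lambda>j. c * mv n A v j)"
  by (simp add: mv_def sum_distrib_left algebra_simps)

lemma opnorm_eq: "opnorm n A = Sup {vnorm n (mv n A v) | v. vnorm n v \<le> 1}"
  by (simp add: opnorm_def vnorm_le_1_iff) (simp add: vnorm_def mv_def L2_set_def)

text \<open>A crude bound whose purpose is to make the set in \<open>opnorm_eq\<close> bounded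
  above; only then does the real-valued \<open>Sup\<close> dominate its members.\<close>

lemma vnorm_mv_le_entries:
  assumes "vnorm n v \<le> 1"
  shows "vnorm n (mv n A v) \<le> (\<Sum>j<n. \<Sum>k<n. cmod (A j k))"
proof -
  have "vnorm n (mv n A v) \<le> (\<Sum>j<n. cmod (mv n A v j))"
    unfolding vnorm_def by (rule L2_set_le_sum) simp
  also have "\<dots> \<le> (\<Sum>j<n. \<Sum>k<n. cmod (A j k))"
  proof (rule sum_mono)
    fix j
    have "cmod (A j k) * cmod (v k) \<le> cmod (A j k)" if "k < n" for k
      using cmod_le_vnorm[OF that, of v] assms by (intro mult_left_le) auto
    then show "cmod (mv n A v j) \<le> (\<Sum>k<n. cmod (A j k))"
      unfolding mv_def by (intro sum_norm_le) (auto simp: norm_mult)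
  qed
  finally show ?thesis .
qed

lemma opnorm_le:
  assumes "\<And>v. vnorm n v \<le> 1 \<Longrightarrow> vnorm n (mv n A v) \<le> c"
  shows "opnorm n A \<le> c"
  unfolding opnorm_eq
proof (rule cSup_least)
  show "{vnorm n (mv n A v) |v. vnorm n v \<le> 1} \<noteq> {}"
    using vnorm_zero[of n] by (auto intro!: exI[of _ "\<lambda>k. 0"])
qed (use assms in auto)

lemma vnorm_mv_le_opnorm_unit:
  assumes "vnorm n v \<le> 1"
  shows "vnorm n (mv n A v) \<le> opnorm n A"
  unfolding opnorm_eq
  by (rule cSup_upper) (use assms vnorm_mv_le_entries in \<open>auto intro!: bdd_aboveI\<close>)

lemma opnorm_nonneg [simp]: "0 \<le> opnorm n A"
  using vnorm_mv_le_opnorm_unit[of n "\<lambda>k. 0" A] by (simp add: order_trans[OF vnorm_nonneg])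

lemma opnorm_le_entries: "opnorm n A \<le> (\<Sum>j<n. \<Sum>k<n. cmod (A j k))"
  by (rule opnorm_le) (rule vnorm_mv_le_entries)

lemma opnorm_zero [simp]: "opnorm n (\<lambda>j k. 0) = 0"
  using opnorm_le_entries[of n "\<lambda>j k. 0"] by (simp add: order.antisym)

lemma unit_multiple:
  obtains w where "vnorm n w \<le> 1" "\<And>k. k < n \<Longrightarrow> v k = complex_of_real (vnorm n v) * w k"
proof
  \<comment> \<open>Since \<open>inverse 0 = 0\<close>, this witness is the zero vector when
    \<open>vnorm n v = 0\<close>, and both claims survive.\<close>
  let ?w = "\<lambda>k. complex_of_real (inverse (vnorm n v)) * v k"
  show "vnorm n ?w \<le> 1"
    by (subst vnorm_scale) (cases "vnorm n v = 0", auto simp: norm_inverse)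
  show "v k = complex_of_real (vnorm n v) * ?w k" if "k < n" for k
    using vnorm_eq_0_imp[OF _ that, of v] by (cases "vnorm n v = 0") auto
qed

lemma vnorm_mv_le: "vnorm n (mv n A v) \<le> opnorm n A * vnorm n v"
proof -
  obtain w where w: "vnorm n w \<le> 1" "\<And>k. k < n \<Longrightarrow> v k = complex_of_real (vnorm n v) * w k"
    using unit_multiple[of n v] by blast
  have "vnorm n (mv n A v) = vnorm n v * vnorm n (mv n A w)"
    using mv_cong[OF w(2), where A=A] by (simp add: mv_scale vnorm_scale)
  also have "\<dots> \<le> vnorm n v * opnorm n A"
    by (intro mult_left_mono vnorm_mv_le_opnorm_unit w) simp
  finally show ?thesis by (simp add: mult.commute)
qed

section \<open>Inner products, adjoints and products of matrices\<close>

lemma cmod_inner_le: "cmod (\<Sum>j<n. a j * cnj (b j)) \<le> vnorm n a * vnorm n b"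
proof -
  have "cmod (\<Sum>j<n. a j * cnj (b j)) \<le> (\<Sum>j<n. \<bar>cmod (a j)\<bar> * \<bar>cmod (b j)\<bar>)"
    by (rule sum_norm_le) (simp add: norm_mult)
  also have "\<dots> \<le> vnorm n a * vnorm n b"
    unfolding vnorm_def by (rule L2_set_mult_ineq)
  finally show ?thesis .
qed

lemma inner_self: "(\<Sum>j<n. a j * cnj (a j)) = complex_of_real ((vnorm n a)^2)"
  by (simp add: vnorm_power2 complex_norm_square del: of_real_power)

text \<open>With y = A* v, Cauchy-Schwarz gives |y|^2 = |<v, A y>| \<le> c |v| |y|, and a nonzero
  |y| can be divided out.\<close>

lemma vnorm_adjoint_le:
  assumes "\<And>v. vnorm n (mv n A v) \<le> c * vnorm n v"
  shows "vnorm n (mv n (\<lambda>j k. cnj (A k j)) v) \<le> c * vnorm n v"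
proof -
  define y where "y = mv n (\<lambda>j k. cnj (A k j)) v"
  have "(\<Sum>j<n. y j * cnj (y j)) = (\<Sum>j<n. \<Sum>k<n. v k * cnj (A k j * y j))"
    by (subst y_def) (simp add: mv_def sum_distrib_right sum_distrib_left algebra_simps)
  also have "\<dots> = (\<Sum>k<n. v k * cnj (mv n A y k))"
    by (subst sum.swap) (simp add: mv_def sum_distrib_left)
  finally have "complex_of_real ((vnorm n y)^2) = (\<Sum>k<n. v k * cnj (mv n A y k))"
    by (simp add: inner_self)
  then have "(vnorm n y)^2 = cmod (\<Sum>k<n. v k * cnj (mv n A y k))"
    by (metis abs_of_nonneg norm_of_real zero_le_power2)
  also have "\<dots> \<le> vnorm n v * vnorm n (mv n A y)"
    by (rule cmod_inner_le)
  also have "\<dots> \<le> vnorm n v * (c * vnorm n y)"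
    by (intro mult_left_mono assms) simp
  finally have *: "vnorm n y * vnorm n y \<le> (c * vnorm n v) * vnorm n y"
    by (simp add: power2_eq_square algebra_simps)
  show ?thesis
  proof (cases "vnorm n y = 0")
    case True
    have "0 \<le> c * vnorm n v"
      using assms[of v] order_trans[OF vnorm_nonneg] by blast
    with True show ?thesis by (simp add: y_def)
  next
    case False
    then have "0 < vnorm n y" using vnorm_nonneg[of n y] by linarith
    with * show ?thesis unfolding y_def[symmetric] by (rule mult_right_le_imp_le)
  qed
qed

text \<open>Triangle inequality for the sum of the products A_i B_i, each of norm at most r_i^2. It
  serves the row norm with B_i = A_i* and the column norm with A_i = B_i*, which is why both factors
  share the bound r_i.\<close>

lemma opnorm_sum_products_le:
  assumes A: "\<And>i v. i < m \<Longrightarrow> vnorm n (mv n (A i) v) \<le> r i * vnorm n v"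
    and B: "\<And>i v. i < m \<Longrightarrow> vnorm n (mv n (B i) v) \<le> r i * vnorm n v"
    and r: "\<And>i. i < m \<Longrightarrow> 0 \<le> r i"
  shows "opnorm n (\<lambda>j k. \<Sum>i<(m::nat). \<Sum>l<n. A i j l * B i l k) \<le> (\<Sum>i<m. (r i)^2)"
proof (rule opnorm_le)
  fix v assume v: "vnorm n v \<le> 1"
  have "mv n (\<lambda>j k. \<Sum>i<m. \<Sum>l<n. A i j l * B i l k) v = (\<lambda>j. \<Sum>i<m. mv n (A i) (mv n (B i) v) j)"
  proof
    fix j
    have "mv n (\<lambda>j k. \<Sum>i<m. \<Sum>l<n. A i j l * B i l k) v j
        = (\<Sum>i<m. \<Sum>k<n. \<Sum>l<n. A i j l * B i l k * v k)"
      unfolding mv_def sum_distrib_right by (rule sum.swap)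
    also have "\<dots> = (\<Sum>i<m. \<Sum>l<n. \<Sum>k<n. A i j l * B i l k * v k)"
      by (intro sum.cong refl sum.swap)
    also have "\<dots> = (\<Sum>i<m. mv n (A i) (mv n (B i) v) j)"
      by (simp add: mv_def sum_distrib_left mult.assoc)
    finally show "mv n (\<lambda>j k. \<Sum>i<m. \<Sum>l<n. A i j l * B i l k) v j = (\<Sum>i<m. mv n (A i) (mv n (B i) v) j)" .
  qed
  then have "vnorm n (mv n (\<lambda>j k. \<Sum>i<m. \<Sum>l<n. A i j l * B i l k) v)
      \<le> (\<Sum>i<m. vnorm n (mv n (A i) (mv n (B i) v)))"
    by (simp add: vnorm_sum)
  also have "\<dots> \<le> (\<Sum>i<m. (r i)^2)"
  proof (rule sum_mono)
    fix i assume i: "i \<in> {..<m}"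
    then have i: "i < m" by simp
    have "vnorm n (mv n (A i) (mv n (B i) v)) \<le> r i * vnorm n (mv n (B i) v)"
      by (rule A[OF i])
    also have "\<dots> \<le> r i * (r i * vnorm n v)"
      by (intro mult_left_mono B i r)
    also have "\<dots> \<le> r i * (r i * 1)"
      by (intro mult_left_mono v r i)
    finally show "vnorm n (mv n (A i) (mv n (B i) v)) \<le> (r i)^2"
      by (simp add: power2_eq_square)
  qed
  finally show "vnorm n (mv n (\<lambda>j k. \<Sum>i<m. \<Sum>l<n. A i j l * B i l k) v) \<le> (\<Sum>i<m. (r i)^2)" .
qed

lemma vnorm_basis: "k < n \<Longrightarrow> vnorm n (basis k) = 1"
  by (simp add: vnorm_def L2_set_def basis_def if_distrib[of cmod] if_distrib[of "\<lambda>x. x^2"] cong: if_cong)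

lemma mv_basis: "k < n \<Longrightarrow> mv n A (basis k) j = A j k"
  by (simp add: mv_def basis_def if_distrib[of "\<lambda>x. A j _ * x"] cong: if_cong)

lemma cmod_diagonal_le_opnorm: "j < n \<Longrightarrow> cmod (A j j) \<le> opnorm n A"
  using cmod_le_vnorm[of j n "mv n A (basis j)"] vnorm_mv_le_opnorm_unit[of n "basis j" A]
  by (simp add: vnorm_basis mv_basis)

section \<open>The normalized Hilbert-Schmidt norm\<close>

text \<open>The square is the normalized trace of the sum of T_i* T_i over i < m, the T_i being the
  coordinate matrices of \<open>X\<close>. Writing it as one \<open>L2_set\<close> over triples
  makes Minkowski and Cauchy-Schwarz directly available. For \<open>n = 0\<close> the value is
  0.\<close>

definition tnorm :: "nat \<Rightarrow> nat \<Rightarrow> hmat \<Rightarrow> real" where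
  "tnorm m n X = L2_set (\<lambda>(j,k,i). cmod (X j k i)) ({..<n}\<times>{..<n}\<times>{..<m}) / sqrt n"

lemma tnorm_nonneg [simp]: "0 \<le> tnorm m n X"
  by (simp add: tnorm_def)

lemma tnorm_power2: "(tnorm m n X)^2 = (\<Sum>i<m. \<Sum>j<n. \<Sum>k<n. (cmod (X j k i))^2) / n"
proof -
  have "(\<Sum>x\<in>{..<n}\<times>{..<n}\<times>{..<m}. case x of (j,k,i) \<Rightarrow> (cmod (X j k i))^2)
      = (\<Sum>j<n. \<Sum>k<n. \<Sum>i<m. (cmod (X j k i))^2)"
    by (simp add: sum.cartesian_product case_prod_unfold)
  also have "\<dots> = (\<Sum>j<n. \<Sum>i<m. \<Sum>k<n. (cmod (X j k i))^2)"
    by (intro sum.cong refl sum.swap)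
  also have "\<dots> = (\<Sum>i<m. \<Sum>j<n. \<Sum>k<n. (cmod (X j k i))^2)"
    by (rule sum.swap)
  finally show ?thesis
    by (simp add: tnorm_def L2_set_def power_divide sum_nonneg case_prod_unfold)
qed

lemma tnorm_add: "tnorm m n (hadd A B) \<le> tnorm m n A + tnorm m n B"
proof -
  let ?S = "{..<n}\<times>{..<n}\<times>{..<m}"
  have "L2_set (\<lambda>(j,k,i). cmod (hadd A B j k i)) ?S
      \<le> L2_set (\<lambda>p. (case p of (j,k,i) \<Rightarrow> cmod (A j k i)) + (case p of (j,k,i) \<Rightarrow> cmod (B j k i))) ?S"
    by (rule L2_set_mono) (auto simp: hadd_def norm_triangle_ineq)
  also have "\<dots> \<le> L2_set (\<lambda>(j,k,i). cmod (A j k i)) ?S + L2_set (\<lambda>(j,k,i). cmod (B j k i)) ?S"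
    by (rule L2_set_triangle_ineq)
  finally show ?thesis
    by (simp add: tnorm_def divide_right_mono flip: add_divide_distrib)
qed

lemma tnorm_cong:
  assumes "\<And>j k. j < n \<Longrightarrow> k < n \<Longrightarrow> X j k = Y j k"
  shows "tnorm m n X = tnorm m n Y"
  unfolding tnorm_def by (intro arg_cong2[where f="(/)"] L2_set_cong) (auto simp: assms)

text \<open>Every diagonal entry is at most the operator norm, hence so is their average, the
  normalized trace.\<close>

lemma average_diagonal_le_opnorm:
  assumes "\<And>j. j < n \<Longrightarrow> P j j = complex_of_real (p j)" and "0 < n"
  shows "(\<Sum>j<n. p j) / n \<le> opnorm n P"
proof -
  have "p j \<le> opnorm n P" if "j < n" for j
    using cmod_diagonal_le_opnorm[OF that, of P] assms(1)[OF that] by simp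
  then have "(\<Sum>j<n. p j) \<le> (\<Sum>j<n. opnorm n P)"
    by (intro sum_mono) auto
  then show ?thesis
    using assms(2) by (simp add: divide_simps algebra_simps)
qed

lemma tnorm_zero_dim [simp]: "tnorm m 0 X = 0"
  by (simp add: tnorm_def)

text \<open>The square of \<open>tnorm\<close> is the normalized trace of the matrix whose operator
  norm defines the row norm. The column norm is treated in the same way, since T T* and T* T have
  equal trace.\<close>

lemma tnorm_le_normR: "ereal (tnorm m n X) \<le> normR n X"
proof -
  let ?P = "\<lambda>j k. \<Sum>i<m. \<Sum>l<n. coef X i j l * cnj (coef X i k l)"
  have "tnorm m n X \<le> sqrt (opnorm n ?P)"
  proof (cases "n = 0")
    case False
    have "(tnorm m n X)^2 = (\<Sum>j<n. \<Sum>i<m. \<Sum>l<n. (cmod (X j l i))^2) / n"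
      by (simp add: tnorm_power2 sum.swap[of _ "{..<m}" "{..<n}"])
    also have "\<dots> \<le> opnorm n ?P"
      using False by (intro average_diagonal_le_opnorm)
        (auto simp: coef_def complex_norm_square simp del: of_real_power)
    finally show ?thesis by (rule real_le_rsqrt)
  qed simp
  then show ?thesis
    unfolding normR_def by (intro SUP_upper2[of m]) auto
qed

lemma tnorm_le_normC: "ereal (tnorm m n X) \<le> normC n X"
proof -
  let ?P = "\<lambda>j k. \<Sum>i<m. \<Sum>l<n. cnj (coef X i l j) * coef X i l k"
  have "tnorm m n X \<le> sqrt (opnorm n ?P)"
  proof (cases "n = 0")
    case False
    have "(tnorm m n X)^2 = (\<Sum>i<m. \<Sum>j<n. \<Sum>l<n. (cmod (X l j i))^2) / n"
      unfolding tnorm_power2 by (intro arg_cong2[where f="(/)"] sum.cong refl sum.swap)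
    also have "\<dots> = (\<Sum>j<n. \<Sum>i<m. \<Sum>l<n. (cmod (X l j i))^2) / n"
      by (simp add: sum.swap[of _ "{..<m}" "{..<n}"])
    also have "\<dots> \<le> opnorm n ?P"
      using False by (intro average_diagonal_le_opnorm)
        (auto simp: coef_def complex_norm_square mult.commute simp del: of_real_power)
    finally show ?thesis by (rule real_le_rsqrt)
  qed simp
  then show ?thesis
    unfolding normC_def by (intro SUP_upper2[of m]) auto
qed

text \<open>In any decomposition X = A + B, the part \<open>A\<close> is controlled by the row norm
  and \<open>B\<close> by the column norm, so the triangle inequality for \<open>tnorm\<close>
  suffices.\<close>

lemma tnorm_le_normSum: "ereal (tnorm m n X) \<le> normSum n X"
  unfolding normSum_def
proof (rule INF_greatest, clarsimp)
  fix A B assume "\<forall>j<n. \<forall>k<n. X j k = hadd A B j k"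
  then have "tnorm m n X = tnorm m n (hadd A B)"
    by (intro tnorm_cong) auto
  then have "tnorm m n X \<le> tnorm m n A + tnorm m n B"
    by (simp add: tnorm_add)
  then have "ereal (tnorm m n X) \<le> ereal (tnorm m n A) + ereal (tnorm m n B)"
    by simp
  also have "\<dots> \<le> normR n A + normC n B"
    by (intro add_mono tnorm_le_normR tnorm_le_normC)
  finally show "ereal (tnorm m n X) \<le> normR n A + normC n B" .
qed

section \<open>Continuity of coordinates in the sum norm\<close>

lemma coordinate_le_tnorm:
  assumes "j < n" "k < n" "i < m"
  shows "cmod (X j k i) \<le> sqrt n * tnorm m n X"
proof -
  have "(case (j,k,i) of (j,k,i) \<Rightarrow> cmod (X j k i)) \<le> L2_set (\<lambda>(j,k,i). cmod (X j k i)) ({..<n}\<times>{..<n}\<times>{..<m})"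
    by (rule member_le_L2_set) (use assms in auto)
  then show ?thesis using assms by (simp add: tnorm_def)
qed

lemma coordinate_le_normSum:
  assumes "j < n" "k < n"
  shows "ereal (cmod (X j k i)) \<le> ereal (sqrt n) * normSum n X"
proof -
  have "ereal (cmod (X j k i)) \<le> ereal (sqrt n) * ereal (tnorm (Suc i) n X)"
    using coordinate_le_tnorm[OF assms, of i "Suc i" X] by simp
  also have "\<dots> \<le> ereal (sqrt n) * normSum n X"
    by (intro ereal_mult_left_mono tnorm_le_normSum) simp
  finally show ?thesis .
qed

text \<open>This turns the vector-valued continuity and differentiability demanded by
  \<open>calderon_adm\<close> into statements on scalar functions, to which complex analysis
  applies.\<close>

lemma coordinate_tendsto_0:
  assumes "((\<lambda>w. normSum n (g w)) \<longlongrightarrow> 0) F" "j < n" "k < n"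
  shows "((\<lambda>w. g w j k i) \<longlongrightarrow> 0) F"
proof -
  have "((\<lambda>w. ereal (sqrt n) * normSum n (g w)) \<longlongrightarrow> ereal (sqrt n) * 0) F"
    by (intro tendsto_cmult_ereal assms) simp
  then have "((\<lambda>w. ereal (sqrt n) * normSum n (g w)) \<longlongrightarrow> 0) F"
    by simp
  then have "((\<lambda>w. ereal (cmod (g w j k i))) \<longlongrightarrow> 0) F"
    by (rule tendsto_sandwich[OF _ _ tendsto_const, rotated 2])
      (auto intro!: always_eventually coordinate_le_normSum assms)
  then have "((\<lambda>w. cmod (g w j k i)) \<longlongrightarrow> 0) F"
    by (simp add: zero_ereal_def)
  then show ?thesis by (rule tendsto_norm_zero_cancel)
qed

section \<open>The three lines theorem\<close>

text \<open>The strip is unbounded, so \<open>g\<close> is first damped by the factor exp (e (w^2 -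
  1)). The maximum modulus principle then applies on a tall rectangle, and e tends to 0 at the
  end.\<close>

lemma bounded_strip_maximum:
  fixes g :: "complex \<Rightarrow> complex"
  assumes cont: "continuous_on strip g" and hol: "g holomorphic_on open_strip"
    and bdd: "\<And>z. z \<in> strip \<Longrightarrow> cmod (g z) \<le> B"
    and left: "\<And>t::real. cmod (g (\<i> * of_real t)) \<le> M"
    and right: "\<And>t::real. cmod (g (1 + \<i> * of_real t)) \<le> M"
    and z: "z \<in> open_strip"
  shows "cmod (g z) \<le> M"
proof -
  have M: "0 \<le> M" using left[of 0] norm_ge_zero order_trans by blast
  have edges: "cmod (g w) \<le> M" if "Re w = 0 \<or> Re w = 1" for w
  proof -
    have "w = \<i> * of_real (Im w) \<or> w = 1 + \<i> * of_real (Im w)"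
      using that by (auto simp: complex_eq_iff)
    then show ?thesis using left[of "Im w"] right[of "Im w"] by auto
  qed
  \<comment> \<open>The real part of w^2 - 1 is (Re w)^2 - (Im w)^2 - 1, and (Re w)^2 \<le> 1 on the
    strip.\<close>
  have decay: "cmod (exp (of_real e * (w^2 - 1))) \<le> exp (- (e * (Im w)^2))"
    if "w \<in> strip" "0 < e" for w e
  proof -
    have "(Re w)^2 \<le> 1" using that by (auto simp: strip_def intro: power_le_one)
    then have "e * ((Re w)^2 - (Im w)^2 - 1) \<le> e * (- ((Im w)^2))"
      using that by (intro mult_left_mono) auto
    then show ?thesis by (simp add: power2_eq_square)
  qed
  have main: "cmod (g z) * cmod (exp (of_real e * (z^2 - 1))) \<le> M + e" if e: "0 < e" for e :: real
  proof -
    let ?h = "\<lambda>w. g w * exp (of_real e * (w^2 - 1))"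
    have "((\<lambda>y::real. B * exp (- (e * y^2))) \<longlongrightarrow> 0) at_top"
      using e by real_asymp
    then have "eventually (\<lambda>y. B * exp (- (e * y^2)) < M + e) at_top"
      by (rule order_tendstoD) (use M e in auto)
    then have "eventually (\<lambda>y. B * exp (- (e * y^2)) < M + e \<and> \<bar>Im z\<bar> < y \<and> 0 < y) at_top"
      by (intro eventually_conj eventually_gt_at_top)
    \<comment> \<open>The height \<open>T\<close> is large enough for the rectangle to contain
      \<open>z\<close> and for the damping to push the global bound \<open>B\<close> below
      \<open>M + e\<close> on the horizontal edges.\<close>
    then obtain T where T: "0 < T" "\<bar>Im z\<bar> < T" "B * exp (- (e * T^2)) < M + e"
      by (auto simp: eventually_at_top_linorder)
    define S where "S = box (Complex 0 (-T)) (Complex 1 T)"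
    have ne: "S \<noteq> {}" unfolding S_def box_ne_empty by (auto simp: Basis_complex_def T)
    have cl: "closure S = cbox (Complex 0 (-T)) (Complex 1 T)"
      using ne unfolding S_def by (rule closure_box)
    have fr: "frontier S = cbox (Complex 0 (-T)) (Complex 1 T) - S"
      using ne unfolding S_def by (simp add: frontier_box)
    have "cmod (?h z) \<le> M + e"
    proof (rule maximum_modulus_frontier[of ?h S])
      have "interior S \<subseteq> open_strip"
        by (auto simp: S_def interior_open[OF open_box] in_box_complex_iff open_strip_def)
      then show "?h holomorphic_on interior S"
        by (intro holomorphic_intros holomorphic_on_subset[OF hol])
      have "closure S \<subseteq> strip"
        by (auto simp: cl in_cbox_complex_iff strip_def)
      then show "continuous_on (closure S) ?h"
        by (intro continuous_intros continuous_on_subset[OF cont])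
      show "bounded S" by (simp add: S_def)
      show "z \<in> S" using z T by (auto simp: S_def in_box_complex_iff open_strip_def)
      fix w assume "w \<in> frontier S"
      then have w: "0 \<le> Re w" "Re w \<le> 1" "-T \<le> Im w" "Im w \<le> T"
        and "Re w = 0 \<or> Re w = 1 \<or> Im w = -T \<or> Im w = T"
        unfolding fr by (auto simp: S_def in_box_complex_iff in_cbox_complex_iff)
      then consider "Re w = 0 \<or> Re w = 1" | "(Im w)^2 = T^2" by auto
      then show "cmod (?h w) \<le> M + e"
      proof cases
        case 1
        have "exp (- (e * (Im w)^2)) \<le> 1" using e by simp
        then have "cmod (exp (of_real e * (w^2 - 1))) \<le> 1"
          using decay[of w e] w e by (auto simp: strip_def intro: order_trans)
        then have "cmod (g w) * cmod (exp (of_real e * (w^2 - 1))) \<le> M * 1"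
          using edges[OF 1] M by (intro mult_mono) auto
        then show ?thesis using e by (simp add: norm_mult)
      next
        case 2
        have "w \<in> strip" using w by (simp add: strip_def)
        then have "cmod (g w) * cmod (exp (of_real e * (w^2 - 1))) \<le> B * exp (- (e * T^2))"
          using bdd[of w] decay[of w e] e 2 order_trans[OF norm_ge_zero bdd[of w]]
          by (intro mult_mono) auto
        then show ?thesis using T(3) by (simp add: norm_mult)
      qed
    qed
    then show ?thesis by (simp add: norm_mult)
  qed
  have "((\<lambda>e::real. cmod (g z) * cmod (exp (of_real e * (z^2 - 1)))) \<longlongrightarrow>
      cmod (g z) * cmod (exp (of_real 0 * (z^2 - 1)))) (at_right 0)"
    by (intro tendsto_intros)
  then have lim: "((\<lambda>e::real. cmod (g z) * cmod (exp (of_real e * (z^2 - 1)))) \<longlongrightarrow> cmod (g z)) (at_right 0)"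
    by simp
  have "((\<lambda>e::real. M + e) \<longlongrightarrow> M + 0) (at_right 0)"
    by (intro tendsto_intros)
  moreover have "eventually (\<lambda>e::real. cmod (g z) * cmod (exp (of_real e * (z^2 - 1))) \<le> M + e) (at_right 0)"
    by (rule eventually_mono[OF eventually_at_right_less]) (rule main)
  ultimately show ?thesis
    using tendsto_le[OF _ _ lim] by fastforce
qed

text \<open>Duality reduces the claim to a scalar function: pair f(z) with the fixed element
  \<open>X\<close>. Cauchy-Schwarz bounds the pairing on both edges, and at \<theta> it equals
  \<open>n\<close> times the square of \<open>tnorm m n X\<close>, so one factor can be
  cancelled.\<close>

lemma tnorm_le_calderon_norm:
  assumes adm: "calderon_adm n \<theta> X f" and \<theta>: "0 < \<theta>" "\<theta> < 1"
  shows "ereal (tnorm m n X) \<le> calderon_norm n f"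
proof (cases "tnorm m n X = 0 \<or> calderon_norm n f = \<infinity>")
  case True
  \<comment> \<open>Nonnegativity of the Calderon norm is what settles the case
    \<open>tnorm m n X = 0\<close>.\<close>
  have "0 \<le> ereal (tnorm m n (f 0))" by simp
  also have "\<dots> \<le> normR n (f (\<i> * of_real 0))" using tnorm_le_normR[of m n "f 0"] by simp
  also have "\<dots> \<le> calderon_norm n f"
    unfolding calderon_norm_def by (rule max.coboundedI1) (rule SUP_upper, simp)
  finally show ?thesis using True by (auto simp: zero_ereal_def)
next
  case False
  have lo: "ereal (tnorm m n (f (\<i> * of_real t))) \<le> calderon_norm n f"
      "ereal (tnorm m n (f (1 + \<i> * of_real t))) \<le> calderon_norm n f" for t :: real
    unfolding calderon_norm_def
    by (intro max.coboundedI1 order_trans[OF tnorm_le_normR] SUP_upper; simp)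
       (intro max.coboundedI2 order_trans[OF tnorm_le_normC] SUP_upper; simp)
  obtain M where M: "calderon_norm n f = ereal M"
    using False lo(1)[of 0] by (cases "calderon_norm n f") auto
  let ?S = "{..<n}\<times>{..<n}\<times>{..<m}"
  let ?L = "\<lambda>X. L2_set (\<lambda>(j,k,i). cmod (X j k i)) ?S"
  define g where "g z = (\<Sum>(j,k,i)\<in>?S. f z j k i * cnj (X j k i))" for z
  have n: "0 < n" using False by (cases "n = 0") auto
  have L: "?L Y = sqrt n * tnorm m n Y" for Y
    using n by (simp add: tnorm_def)
  have g_le: "cmod (g z) \<le> (n * tnorm m n X) * tnorm m n (f z)" for z
  proof -
    have "cmod (g z) \<le> (\<Sum>p\<in>?S. \<bar>case p of (j,k,i) \<Rightarrow> cmod (f z j k i)\<bar> * \<bar>case p of (j,k,i) \<Rightarrow> cmod (X j k i)\<bar>)"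
      unfolding g_def by (rule sum_norm_le) (auto simp: norm_mult)
    also have "\<dots> \<le> ?L (f z) * ?L X"
      by (rule L2_set_mult_ineq)
    also have "\<dots> = (sqrt n * sqrt n) * tnorm m n X * tnorm m n (f z)"
      unfolding L by (simp only: mult_ac)
    finally show ?thesis by simp
  qed
  have coord: "(\<lambda>z. f z j k i) holomorphic_on open_strip" "continuous_on strip (\<lambda>z. f z j k i)"
    if jk: "j < n" "k < n" for j k i
  proof -
    have "open open_strip"
      unfolding open_strip_def
      by (intro open_Collect_conj open_Collect_less continuous_intros)
    moreover have "\<exists>d. ((\<lambda>z. f z j k i) has_field_derivative d) (at z)" if "z \<in> open_strip" for z
    proof -
      have "\<forall>z\<in>open_strip. \<exists>D. Mn_l2 n D \<and>
        ((\<lambda>w. normSum n (hsub (hscale (inverse (w - z)) (hsub (f w) (f z))) D)) \<longlongrightarrow> 0) (at z)"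
        using adm unfolding calderon_adm_def by (elim conjE)
      with that obtain D where
        "((\<lambda>w. normSum n (hsub (hscale (inverse (w - z)) (hsub (f w) (f z))) D)) \<longlongrightarrow> 0) (at z)"
        by blast
      from coordinate_tendsto_0[OF this jk, of i]
      have "((\<lambda>w. (f w j k i - f z j k i) / (w - z) - D j k i) \<longlongrightarrow> 0) (at z)"
        by (simp add: hsub_def hscale_def divide_inverse mult.commute)
      then show ?thesis
        unfolding has_field_derivative_iff by (auto dest: LIM_zero_cancel)
    qed
    ultimately show "(\<lambda>z. f z j k i) holomorphic_on open_strip"
      by (simp add: holomorphic_on_open)
    show "continuous_on strip (\<lambda>z. f z j k i)"
      unfolding continuous_on_def
    proof
      fix z assume "z \<in> strip"
      then have "((\<lambda>w. normSum n (hsub (f w) (f z))) \<longlongrightarrow> 0) (at z within strip)"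
        using adm unfolding calderon_adm_def by blast
      from coordinate_tendsto_0[OF this jk, of i]
      show "((\<lambda>z. f z j k i) \<longlongrightarrow> f z j k i) (at z within strip)"
        by (simp add: hsub_def LIM_zero_iff)
    qed
  qed
  obtain B where B: "\<And>z. z \<in> strip \<Longrightarrow> normSum n (f z) \<le> ereal B"
    using adm unfolding calderon_adm_def by blast
  have "cmod (g (of_real \<theta>)) \<le> (n * tnorm m n X) * M"
  proof (rule bounded_strip_maximum[where g = g and B = "(n * tnorm m n X) * B"])
    have g: "g = (\<lambda>z. \<Sum>p\<in>?S. f z (fst p) (fst (snd p)) (snd (snd p)) * cnj (X (fst p) (fst (snd p)) (snd (snd p))))"
      by (simp add: g_def fun_eq_iff case_prod_unfold)
    show "continuous_on strip g" "g holomorphic_on open_strip"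
      unfolding g by (intro continuous_intros holomorphic_intros coord; auto)+
    show "cmod (g z) \<le> (n * tnorm m n X) * B" if "z \<in> strip" for z
    proof -
      have "tnorm m n (f z) \<le> B"
        using order_trans[OF tnorm_le_normSum B[OF that], of m] by simp
      then show ?thesis
        by (intro order_trans[OF g_le] mult_left_mono) auto
    qed
    show "cmod (g (\<i> * of_real t)) \<le> (n * tnorm m n X) * M"
      "cmod (g (1 + \<i> * of_real t)) \<le> (n * tnorm m n X) * M" for t :: real
      using lo[of t] by (auto simp: M intro!: order_trans[OF g_le] mult_left_mono)
    show "of_real \<theta> \<in> open_strip" using \<theta> by (simp add: open_strip_def)
  qed
  moreover have "g (of_real \<theta>) = of_real (n * (tnorm m n X)^2)"
  proof -
    have "f (of_real \<theta>) j k = X j k" if "j < n" "k < n" for j k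
      using adm that unfolding calderon_adm_def by blast
    then have "g (of_real \<theta>) = (\<Sum>(j,k,i)\<in>?S. X j k i * cnj (X j k i))"
      unfolding g_def by (intro sum.cong) auto
    also have "\<dots> = of_real (\<Sum>p\<in>?S. (case p of (j,k,i) \<Rightarrow> cmod (X j k i))^2)"
      by (simp add: complex_norm_square case_prod_unfold del: of_real_power)
    also have "(\<Sum>p\<in>?S. (case p of (j,k,i) \<Rightarrow> cmod (X j k i))^2) = (?L X)^2"
      by (simp add: L2_set_def sum_nonneg)
    finally show ?thesis by (simp add: L power_mult_distrib)
  qed
  ultimately have "(n * tnorm m n X) * tnorm m n X \<le> (n * tnorm m n X) * M"
    by (simp add: norm_mult norm_power power2_eq_square mult.assoc del: of_real_mult of_real_power)
  moreover have "0 < n * tnorm m n X"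
    using False n order.not_eq_order_implies_strict[OF _ tnorm_nonneg, of m n X] by simp
  ultimately have "tnorm m n X \<le> M"
    by (rule mult_left_le_imp_le)
  then show ?thesis by (simp add: M)
qed

lemma tnorm_le_normRtheta:
  assumes "0 \<le> \<theta>" "\<theta> \<le> 1"
  shows "ereal (tnorm m n X) \<le> normRtheta \<theta> n X"
  using assms tnorm_le_normR tnorm_le_normC tnorm_le_calderon_norm
  by (auto simp: normRtheta_def normInterp_def intro!: INF_greatest)

text \<open>The constant function with value \<open>X\<close> is admissible, and its edge norms are
  the row and the column norm of \<open>X\<close>. At the endpoints \<theta> = 0 and \<theta> = 1
  the hypotheses give the bound themselves.\<close>

lemma normRtheta_le_max:
  assumes "0 \<le> \<theta>" "\<theta> \<le> 1" "Mn_l2 n X" and R: "normR n X \<le> ereal K" and C: "normC n X \<le> ereal K"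
  shows "normRtheta \<theta> n X \<le> ereal K"
proof -
  have zero: "normR n (\<lambda>j k i. 0) = 0" "normC n (\<lambda>j k i. 0) = 0"
    and Mz: "Mn_l2 n (\<lambda>j k i. 0)"
    by (simp_all add: normR_def normC_def coef_def Mn_l2_def l2_def)
  have sum0: "normSum n (\<lambda>j k i. 0) = 0"
  proof (rule antisym)
    show "normSum n (\<lambda>j k i. 0) \<le> 0"
      unfolding normSum_def
      by (rule INF_lower2[of "(\<lambda>j k i. 0, \<lambda>j k i. 0)"]) (auto simp: zero Mz hadd_def)
    show "0 \<le> normSum n (\<lambda>j k i. 0)"
      using tnorm_le_normSum[of 0 n "\<lambda>j k i. 0"] order_trans[of 0 "ereal (tnorm 0 n (\<lambda>j k i. 0))"] by simp
  qed
  \<comment> \<open>The decomposition X = X + 0 provides the uniform bound on the strip that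
    admissibility asks for.\<close>
  have sumX: "normSum n X \<le> ereal K"
    unfolding normSum_def
    by (rule INF_lower2[of "(X, \<lambda>j k i. 0)"]) (auto simp: zero Mz assms hadd_def)
  have "calderon_adm n \<theta> X (\<lambda>z. X)"
    unfolding calderon_adm_def
    using assms sumX Mz by (auto simp: hsub_def hscale_def zero sum0 intro!: exI[of _ "\<lambda>j k i. 0"])
  then have "normInterp \<theta> n X \<le> calderon_norm n (\<lambda>z. X)"
    unfolding normInterp_def by (intro INF_lower) simp
  also have "\<dots> \<le> ereal K"
    using R C by (simp add: calderon_norm_def)
  finally show ?thesis using R C by (simp add: normRtheta_def)
qed

section \<open>Operators on the sequence space\<close>

lemma l2_summable: "x \<in> l2 \<Longrightarrow> summable (\<lambda>i. (cmod (x i))^2)"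
  by (simp add: l2_def)

lemma hnorm_power2: "x \<in> l2 \<Longrightarrow> (hnorm x)^2 = (\<Sum>i. (cmod (x i))^2)"
  by (simp add: hnorm_def l2_def suminf_nonneg)

lemma vnorm_le_hnorm: "x \<in> l2 \<Longrightarrow> vnorm N x \<le> hnorm x"
  unfolding hnorm_def vnorm_def L2_set_def
  by (intro real_sqrt_le_mono sum_le_suminf l2_summable) auto

lemma hnorm_nonneg: "x \<in> l2 \<Longrightarrow> 0 \<le> hnorm x"
  using vnorm_le_hnorm[of x 0] by (simp add: order_trans[OF vnorm_nonneg])

lemma cmod_le_hnorm: "x \<in> l2 \<Longrightarrow> cmod (x i) \<le> hnorm x"
  using cmod_le_vnorm[of i "Suc i" x] vnorm_le_hnorm[of x "Suc i"] by simp

lemma hnorm_le: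
  assumes "\<And>N. vnorm N x \<le> K" and "x \<in> l2"
  shows "hnorm x \<le> K"
proof -
  have K: "0 \<le> K" using assms(1)[of 0] order_trans[OF vnorm_nonneg] by blast
  have "(\<Sum>i<N. (cmod (x i))^2) \<le> K^2" for N
    using power_mono[OF assms(1)[of N], of 2] by (simp add: vnorm_power2)
  then have "(\<Sum>i. (cmod (x i))^2) \<le> K^2"
    by (intro suminf_le_const l2_summable assms)
  then show ?thesis
    unfolding hnorm_def using K by (rule real_le_lsqrt[rotated])
qed

section \<open>Truncation and the matrix of an operator\<close>

definition trunc :: "nat \<Rightarrow> (nat \<Rightarrow> complex) \<Rightarrow> (nat \<Rightarrow> complex)" where
  "trunc N x = (\<lambda>i. if i < N then x i else 0)"

lemma finite_support_l2: "(\<And>i. N \<le> i \<Longrightarrow> x i = 0) \<Longrightarrow> x \<in> l2"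
  unfolding l2_def using summable_finite[of "{..<N}" "\<lambda>i. (cmod (x i))^2"] by (auto simp: not_less)

lemma trunc_l2 [simp]: "trunc N x \<in> l2"
  by (rule finite_support_l2[of N]) (simp add: trunc_def)

lemma basis_l2 [simp]: "basis j \<in> l2"
  by (rule finite_support_l2[of "Suc j"]) (simp add: basis_def)

lemma is_operator_l2: "is_operator u \<Longrightarrow> x \<in> l2 \<Longrightarrow> u x \<in> l2"
  by (simp add: is_operator_def)

lemma is_operator_linear:
  "is_operator u \<Longrightarrow> x \<in> l2 \<Longrightarrow> y \<in> l2 \<Longrightarrow> u (\<lambda>i. a * x i + b * y i) = (\<lambda>i. a * u x i + b * u y i)"
  by (simp add: is_operator_def)

lemma is_operator_scale:
  "is_operator u \<Longrightarrow> x \<in> l2 \<Longrightarrow> u (\<lambda>i. a * x i) = (\<lambda>i. a * u x i)"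
  using is_operator_linear[of u x x a 0] by simp

lemma is_operator_trunc:
  assumes "is_operator u"
  shows "u (trunc N x) = (\<lambda>i. \<Sum>l<N. u (basis l) i * x l)"
proof (induction N)
  case 0
  then show ?case
    using is_operator_scale[OF assms basis_l2, of 0] by (simp add: trunc_def)
next
  case (Suc N)
  have "trunc (Suc N) x = (\<lambda>i. 1 * trunc N x i + x N * basis N i)"
    by (auto simp: trunc_def basis_def fun_eq_iff less_Suc_eq)
  then show ?case
    using is_operator_linear[OF assms trunc_l2 basis_l2, of 1 N x "x N" N] Suc
    by (simp add: algebra_simps)
qed

text \<open>The squared norm of the tail is the remainder of a convergent series. The difference is
  written with the factors 1 and -1 so that it is literally a linear combination as in
  \<open>is_operator\<close>.\<close>

lemma hnorm_tail:
  assumes "x \<in> l2"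
  shows "(\<lambda>N. hnorm (\<lambda>i. 1 * x i + (-1) * trunc N x i)) \<longlonglongrightarrow> 0"
proof -
  define a where "a = (\<lambda>i. (cmod (x i))^2)"
  have a: "summable a" unfolding a_def by (rule l2_summable[OF assms])
  have "hnorm (\<lambda>i. 1 * x i + (-1) * trunc N x i) = sqrt (suminf a - (\<Sum>i<N. a i))" for N
  proof -
    have "(\<lambda>i. if i \<in> {..<N} then a i else 0) sums (\<Sum>i<N. a i)"
      by (rule sums_If_finite_set) simp
    from sums_diff[OF summable_sums[OF a] this]
    have "(\<Sum>i. a i - (if i \<in> {..<N} then a i else 0)) = suminf a - (\<Sum>i<N. a i)"
      by (rule sums_unique[symmetric])
    moreover have "(cmod (1 * x i + (-1) * trunc N x i))^2 = a i - (if i \<in> {..<N} then a i else 0)" for i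
      by (cases "i < N") (simp_all add: trunc_def a_def)
    ultimately show ?thesis
      unfolding hnorm_def by (simp only:)
  qed
  moreover have "(\<lambda>N. sqrt (suminf a - (\<Sum>i<N. a i))) \<longlonglongrightarrow> sqrt (suminf a - suminf a)"
    by (intro tendsto_real_sqrt tendsto_diff tendsto_const summable_LIMSEQ a)
  ultimately show ?thesis by simp
qed

text \<open>By boundedness \<open>u (trunc N x)\<close> converges to \<open>u x\<close> in norm,
  hence in each coordinate; this makes \<open>u (basis l) i\<close> the matrix entries of
  \<open>u\<close>.\<close>

lemma operator_coordinate_sums:
  assumes u: "is_operator u" "bounded_op u" and x: "x \<in> l2"
  shows "(\<lambda>l. u (basis l) i * x l) sums u x i"
proof -
  obtain K where K: "\<And>x. x \<in> l2 \<Longrightarrow> hnorm (u x) \<le> K * hnorm x"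
    using u(2) unfolding bounded_op_def by blast
  let ?d = "\<lambda>N. \<lambda>i. 1 * x i + (-1) * trunc N x i"
  have d: "?d N \<in> l2" for N
  proof -
    have "summable (\<lambda>i. if i \<in> {..<N} then 0 else (cmod (x i))^2)"
      by (rule summable_comparison_test'[OF l2_summable[OF x]]) auto
    moreover have "(\<lambda>i. (cmod (?d N i))^2) = (\<lambda>i. if i \<in> {..<N} then 0 else (cmod (x i))^2)"
      by (auto simp: trunc_def)
    ultimately show ?thesis unfolding l2_def by (simp only: mem_Collect_eq)
  qed
  have "norm (u (trunc N x) i - u x i) \<le> K * hnorm (?d N)" for N
  proof -
    have "u (?d N) = (\<lambda>i. 1 * u x i + (-1) * u (trunc N x) i)"
      by (rule is_operator_linear[OF u(1) x trunc_l2])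
    then have "u (?d N) i = 1 * u x i + (-1) * u (trunc N x) i"
      by (rule fun_cong)
    then have "norm (u (trunc N x) i - u x i) = cmod (u (?d N) i)"
      by (simp only: norm_minus_commute mult_1 mult_minus1 add_uminus_conv_diff)
    also have "\<dots> \<le> hnorm (u (?d N))"
      by (intro cmod_le_hnorm is_operator_l2[OF u(1)] d)
    also have "\<dots> \<le> K * hnorm (?d N)"
      by (intro K d)
    finally show ?thesis .
  qed
  moreover have "(\<lambda>N. K * hnorm (?d N)) \<longlonglongrightarrow> 0"
    using tendsto_mult_left[OF hnorm_tail[OF x], of K] by simp
  ultimately have "(\<lambda>N. u (trunc N x) i - u x i) \<longlonglongrightarrow> 0"
    by (rule Lim_null_comparison[OF always_eventually[OF allI]])
  then have "(\<lambda>N. u (trunc N x) i) \<longlonglongrightarrow> u x i"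
    by (rule LIM_zero_cancel)
  then show ?thesis
    by (simp add: sums_def is_operator_trunc[OF u(1)])
qed

section \<open>The upper bound\<close>

text \<open>The unit ball of H_min consists of those \<open>X\<close> whose combinations with unit
  coefficient vectors are contractions; general \<open>v\<close> follows by scaling to a unit
  vector.\<close>

lemma vnorm_combination_le_normMin:
  assumes "normMin n X \<le> 1"
  shows "vnorm n (mv n (\<lambda>j k. \<Sum>i<m. v i * X j k i) w) \<le> vnorm m v * vnorm n w"
proof -
  obtain v' where v': "vnorm m v' \<le> 1" "\<And>i. i < m \<Longrightarrow> v i = complex_of_real (vnorm m v) * v' i"
    using unit_multiple[of m v] by blast
  let ?A = "\<lambda>v j k. \<Sum>i<m. v i * coef X i j k"
  let ?S = "{opnorm n (?A v) | v. (\<Sum>i<m. (cmod (v i))^2) \<le> 1}"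
  have "ereal (Sup ?S) \<le> normMin n X"
    unfolding normMin_def by (rule SUP_upper) simp
  with assms have "Sup ?S \<le> 1"
    using order_trans by force
  \<comment> \<open>Boundedness is needed to compare a member of the set with its real supremum;
    unit vectors have coordinates of modulus at most 1.\<close>
  moreover have "bdd_above ?S"
  proof (rule bdd_aboveI)
    fix y assume "y \<in> ?S"
    then obtain v where v: "y = opnorm n (?A v)" "vnorm m v \<le> 1"
      by (auto simp: vnorm_le_1_iff)
    have "cmod (?A v j k) \<le> (\<Sum>i<m. cmod (coef X i j k))" for j k
    proof (rule sum_norm_le)
      fix i assume "i \<in> {..<m}"
      then have "cmod (v i) \<le> 1" using cmod_le_vnorm[of i m v] v by simp
      then show "cmod (v i * coef X i j k) \<le> cmod (coef X i j k)"
        by (simp add: norm_mult mult_left_le_one_le)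
    qed
    then have "(\<Sum>j<n. \<Sum>k<n. cmod (?A v j k)) \<le> (\<Sum>j<n. \<Sum>k<n. \<Sum>i<m. cmod (coef X i j k))"
      by (intro sum_mono)
    then show "y \<le> (\<Sum>j<n. \<Sum>k<n. \<Sum>i<m. cmod (coef X i j k))"
      unfolding v using opnorm_le_entries[of n "?A v"] by linarith
  qed
  moreover have "opnorm n (?A v') \<in> ?S"
    using v' by (auto simp: vnorm_le_1_iff)
  ultimately have op: "opnorm n (?A v') \<le> 1"
    using cSup_upper[of "opnorm n (?A v')" ?S] by linarith
  have "mv n (\<lambda>j k. \<Sum>i<m. v i * X j k i) w = (\<lambda>j. complex_of_real (vnorm m v) * mv n (?A v') w j)"
    by (auto simp: mv_def coef_def v'(2) sum_distrib_left sum_distrib_right mult.assoc fun_eq_iff intro!: sum.cong)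
  then have "vnorm n (mv n (\<lambda>j k. \<Sum>i<m. v i * X j k i) w) = vnorm m v * vnorm n (mv n (?A v') w)"
    by (simp add: vnorm_scale)
  also have "\<dots> \<le> vnorm m v * (opnorm n (?A v') * vnorm n w)"
    by (intro mult_left_mono vnorm_mv_le) simp
  also have "\<dots> \<le> vnorm m v * (1 * vnorm n w)"
    by (intro mult_left_mono mult_right_mono op) auto
  finally show ?thesis by simp
qed

text \<open>The i-th coordinate matrix of u(X) is the entrywise limit of finite combinations of the
  coordinate matrices of \<open>X\<close>, with coefficients from row i of \<open>u\<close>. Each of
  these obeys the bound, which passes to the limit.\<close>

lemma vnorm_operator_row_le:
  assumes u: "is_operator u" "bounded_op u" and X: "Mn_l2 n X" "normMin n X \<le> 1"
    and row: "(\<lambda>l. u (basis l) i) \<in> l2"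
  shows "vnorm n (mv n (\<lambda>j k. u (X j k) i) w) \<le> hnorm (\<lambda>l. u (basis l) i) * vnorm n w"
proof (rule tendsto_upperbound)
  show "(\<lambda>N. vnorm n (mv n (\<lambda>j k. \<Sum>l<N. u (basis l) i * X j k l) w))
      \<longlonglongrightarrow> vnorm n (mv n (\<lambda>j k. u (X j k) i) w)"
  proof (rule tendsto_vnorm)
    fix j assume "j < n"
    then have "(\<lambda>N. \<Sum>l<N. u (basis l) i * X j k l) \<longlonglongrightarrow> u (X j k) i" if "k < n" for k
      using operator_coordinate_sums[OF u, of "X j k" i] X(1) that by (simp add: Mn_l2_def sums_def)
    then show "(\<lambda>N. mv n (\<lambda>j k. \<Sum>l<N. u (basis l) i * X j k l) w j) \<longlonglongrightarrow> mv n (\<lambda>j k. u (X j k) i) w j"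
      unfolding mv_def by (intro tendsto_sum tendsto_mult tendsto_const) auto
  qed
  show "\<forall>\<^sub>F N in sequentially. vnorm n (mv n (\<lambda>j k. \<Sum>l<N. u (basis l) i * X j k l) w)
      \<le> hnorm (\<lambda>l. u (basis l) i) * vnorm n w"
    by (intro always_eventually allI order_trans[OF vnorm_combination_le_normMin[OF X(2)]]
        mult_right_mono vnorm_le_hnorm row) simp
qed simp

text \<open>The squared matrix entries are summed by rows instead of columns. Taking only finitely
  many rows reduces the exchange to a finite sum of convergent series.\<close>

lemma hilbert_schmidt_rows:
  assumes "hilbert_schmidt u"
  shows "(\<lambda>l. u (basis l) i) \<in> l2"
    and "(\<Sum>i<m. (hnorm (\<lambda>l. u (basis l) i))^2) \<le> (hs_norm u)^2"
proof -
  have op: "is_operator u" and sm: "summable (\<lambda>l. (hnorm (u (basis l)))^2)"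
    using assms by (auto simp: hilbert_schmidt_def)
  have col: "u (basis l) \<in> l2" for l
    by (rule is_operator_l2[OF op basis_l2])
  show row: "(\<lambda>l. u (basis l) i) \<in> l2" for i
    unfolding l2_def
    by (auto intro!: summable_comparison_test'[OF sm] power_mono cmod_le_hnorm col)
  have "(\<Sum>i<m. (hnorm (\<lambda>l. u (basis l) i))^2) = (\<Sum>i<m. \<Sum>l. (cmod (u (basis l) i))^2)"
    by (simp add: hnorm_power2 row)
  also have "\<dots> = (\<Sum>l. \<Sum>i<m. (cmod (u (basis l) i))^2)"
    by (rule suminf_sum[symmetric]) (rule l2_summable[OF row])
  also have "\<dots> \<le> (\<Sum>l. (hnorm (u (basis l)))^2)"
  proof (rule suminf_le)
    show "(\<Sum>i<m. (cmod (u (basis l) i))^2) \<le> (hnorm (u (basis l)))^2" for l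
      unfolding vnorm_power2[symmetric] by (intro power_mono vnorm_le_hnorm col) simp
    show "summable (\<lambda>l. \<Sum>i<m. (cmod (u (basis l) i))^2)"
      by (intro summable_sum l2_summable[OF row])
  qed (rule sm)
  also have "\<dots> = (hs_norm u)^2"
    using suminf_nonneg[OF sm] by (simp add: hs_norm_def)
  finally show "(\<Sum>i<m. (hnorm (\<lambda>l. u (basis l) i))^2) \<le> (hs_norm u)^2" .
qed

lemma hs_norm_nonneg: "hilbert_schmidt u \<Longrightarrow> 0 \<le> hs_norm u"
  by (simp add: hs_norm_def hilbert_schmidt_def suminf_nonneg)

lemma cbnorm_le_hs_norm:
  assumes \<theta>: "0 \<le> \<theta>" "\<theta> \<le> 1" and hs: "hilbert_schmidt u"
  shows "cbnorm \<theta> u \<le> ereal (hs_norm u)"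
  unfolding cbnorm_def
proof (intro SUP_least, clarsimp)
  fix n X assume X: "Mn_l2 n X" "normMin n X \<le> 1"
  have u: "is_operator u" "bounded_op u" using hs by (auto simp: hilbert_schmidt_def)
  let ?r = "\<lambda>i. hnorm (\<lambda>l. u (basis l) i)"
  let ?Y = "\<lambda>j k. u (X j k)"
  have T: "vnorm n (mv n (\<lambda>j k. u (X j k) i) w) \<le> ?r i * vnorm n w" for i w
    by (intro vnorm_operator_row_le u X hilbert_schmidt_rows(1) hs)
  \<comment> \<open>The row and column norms multiply each coordinate matrix by its adjoint on one
    side or the other, so the adjoints need the same bound.\<close>
  note T' = vnorm_adjoint_le[OF T]
  have r: "0 \<le> ?r i" for i by (intro hnorm_nonneg hilbert_schmidt_rows(1) hs)
  show "normRtheta \<theta> n ?Y \<le> ereal (hs_norm u)"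
  proof (rule normRtheta_le_max[OF \<theta>])
    show "Mn_l2 n ?Y" using X(1) by (simp add: Mn_l2_def is_operator_l2[OF u(1)])
    have "opnorm n (\<lambda>j k. \<Sum>i<m. \<Sum>l<n. coef ?Y i j l * cnj (coef ?Y i k l)) \<le> (hs_norm u)^2" for m
      unfolding coef_def
      by (intro order_trans[OF opnorm_sum_products_le hilbert_schmidt_rows(2)[OF hs]] T T' r)
    then show "normR n ?Y \<le> ereal (hs_norm u)"
      unfolding normR_def using hs_norm_nonneg[OF hs] by (intro SUP_least) (auto intro: real_le_lsqrt)
    have "opnorm n (\<lambda>j k. \<Sum>i<m. \<Sum>l<n. cnj (coef ?Y i l j) * coef ?Y i l k) \<le> (hs_norm u)^2" for m
      unfolding coef_def
      by (intro order_trans[OF opnorm_sum_products_le hilbert_schmidt_rows(2)[OF hs]] T T' r)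
    then show "normC n ?Y \<le> ereal (hs_norm u)"
      unfolding normC_def using hs_norm_nonneg[OF hs] by (intro SUP_least) (auto intro: real_le_lsqrt)
  qed
qed

section \<open>The lower bound\<close>

lemma sum_lessThan_add:
  fixes f :: "nat \<Rightarrow> 'a::comm_monoid_add"
  shows "(\<Sum>j<n + m. f j) = (\<Sum>j<n. f j) + (\<Sum>j<m. f (n + j))"
  by (induction m) (simp_all add: add.assoc)

text \<open>Expanding the squares leaves twice the real parts of the two inner products with
  opposite signs, and these are equal by assumption.\<close>

lemma cross_terms_cancel:
  fixes a b c d :: "nat \<Rightarrow> complex"
  assumes "(\<Sum>j<n. a j * cnj (b j)) = (\<Sum>j<n. c j * cnj (d j))"
  shows "(vnorm n (\<lambda>j. a j + b j))^2 + (vnorm n (\<lambda>j. c j - d j))^2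
    = (vnorm n a)^2 + (vnorm n b)^2 + (vnorm n c)^2 + (vnorm n d)^2"
proof -
  have p: "(cmod (x + y))^2 = (cmod x)^2 + (cmod y)^2 + 2 * Re (x * cnj y)" for x y :: complex
    unfolding cmod_power2 by (simp add: power2_eq_square algebra_simps)
  have q: "(cmod (x - y))^2 = (cmod x)^2 + (cmod y)^2 - 2 * Re (x * cnj y)" for x y :: complex
    unfolding cmod_power2 by (simp add: power2_eq_square algebra_simps)
  have "(\<Sum>j<n. Re (a j * cnj (b j))) = (\<Sum>j<n. Re (c j * cnj (d j)))"
    unfolding Re_sum[symmetric] assms ..
  then show ?thesis
    unfolding vnorm_power2 p q sum.distrib sum_subtractf sum_distrib_left[symmetric] by simp
qed

text \<open>The matrices are the annihilation operators on the antisymmetric Fock space over m modes; the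
  identity is the canonical anticommutation relation A* A + A A* = |v|^2 in quadratic form. Adding
  a mode turns the combination A into the block matrix [[A, t], [0, -A]].\<close>

lemma anticommuting_matrices:
  "\<exists>T :: nat \<Rightarrow> cmat. \<forall>v w.
     (vnorm (2^m) (mv (2^m) (\<lambda>j k. \<Sum>i<m. v i * T i j k) w))^2
     + (vnorm (2^m) (mv (2^m) (\<lambda>j k. cnj (\<Sum>i<m. v i * T i k j)) w))^2
     = (vnorm m v)^2 * (vnorm (2^m) w)^2"
proof (induction m)
  case 0
  then show ?case by (simp add: mv_def vnorm_power2)
next
  case (Suc m)
  define n :: nat where "n = 2^m"
  obtain T :: "nat \<Rightarrow> cmat" where T: "\<And>v w.
     (vnorm n (mv n (\<lambda>j k. \<Sum>i<m. v i * T i j k) w))^2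
     + (vnorm n (mv n (\<lambda>j k. cnj (\<Sum>i<m. v i * T i k j)) w))^2
     = (vnorm m v)^2 * (vnorm n w)^2"
    using Suc unfolding n_def by blast
  \<comment> \<open>Old modes act as T_i on the upper block and as -T_i on the lower one; the new
    mode, with index \<open>m\<close>, is the identity in the upper right block.\<close>
  define T' :: "nat \<Rightarrow> cmat" where "T' i j k =
     (if j < n then if k < n then (if i < m then T i j k else 0) else (if i = m \<and> k = n + j then 1 else 0)
      else if k < n then 0 else - (if i < m then T i (j - n) (k - n) else 0))" for i j k
  have "(vnorm (n+n) (mv (n+n) (\<lambda>j k. \<Sum>i<Suc m. v i * T' i j k) w))^2
     + (vnorm (n+n) (mv (n+n) (\<lambda>j k. cnj (\<Sum>i<Suc m. v i * T' i k j)) w))^2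
     = (vnorm (Suc m) v)^2 * (vnorm (n+n) w)^2" for v w
  proof -
    define t where "t = v m"
    define w2 where "w2 = (\<lambda>j. w (n + j))"
    define A where "A = (\<lambda>j k. \<Sum>i<m. v i * T i j k)"
    define A' where "A' = (\<lambda>j k. \<Sum>i<Suc m. v i * T' i j k)"
    have A': "A' j k = A j k" "A' j (n + k) = (if k = j then t else 0)"
       "A' (n + j) k = 0" "A' (n + j) (n + k) = - A j k" if "j < n" "k < n" for j k
      using that by (auto simp: A'_def A_def T'_def t_def sum_negf)
    let ?B = "mv n A" and ?C = "mv n (\<lambda>j k. cnj (A k j))"
    have up: "mv (n+n) A' w j = ?B w j + t * w2 j" if "j < n" for j
      using that by (simp add: mv_def sum_lessThan_add A' w2_def if_distrib[of "\<lambda>x. x * _"] cong: if_cong)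
    have down: "mv (n+n) A' w (n+j) = - ?B w2 j" if "j < n" for j
      using that by (simp add: mv_def sum_lessThan_add A' w2_def sum_negf)
    have up': "mv (n+n) (\<lambda>j k. cnj (A' k j)) w j = ?C w j" if "j < n" for j
      using that by (simp add: mv_def sum_lessThan_add A')
    have down': "mv (n+n) (\<lambda>j k. cnj (A' k j)) w (n+j) = cnj t * w j - ?C w2 j" if "j < n" for j
      using that by (simp add: mv_def sum_lessThan_add A' w2_def sum_negf if_distrib[of "\<lambda>x. x * _"] if_distrib[of cnj] cong: if_cong)
    have split: "(vnorm (n+n) x)^2 = (vnorm n x)^2 + (vnorm n (\<lambda>j. x (n+j)))^2" for x
      by (simp add: vnorm_power2 sum_lessThan_add)
    \<comment> \<open>Moving A to the other side as its adjoint shows that both cross terms agree;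
      the sign of the lower block -A then makes them cancel.\<close>
    have "(\<Sum>j<n. ?B w j * cnj (t * w2 j)) = (\<Sum>j<n. \<Sum>k<n. A j k * w k * cnj (t * w2 j))"
      by (simp add: mv_def sum_distrib_right)
    also have "\<dots> = (\<Sum>k<n. (cnj t * w k) * cnj (?C w2 k))"
      by (subst sum.swap) (simp add: mv_def sum_distrib_left algebra_simps)
    finally have cross: "(vnorm n (\<lambda>j. ?B w j + t * w2 j))^2 + (vnorm n (\<lambda>j. cnj t * w j - ?C w2 j))^2
       = (vnorm n (?B w))^2 + (vnorm n (\<lambda>j. t * w2 j))^2 + (vnorm n (\<lambda>j. cnj t * w j))^2 + (vnorm n (?C w2))^2"
      by (rule cross_terms_cancel)
    have "(vnorm (n+n) (mv (n+n) A' w))^2 + (vnorm (n+n) (mv (n+n) (\<lambda>j k. cnj (A' k j)) w))^2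
      = (vnorm n (\<lambda>j. ?B w j + t * w2 j))^2 + (vnorm n (\<lambda>j. - ?B w2 j))^2
        + ((vnorm n (?C w))^2 + (vnorm n (\<lambda>j. cnj t * w j - ?C w2 j))^2)"
      unfolding split by (simp add: up down up' down' cong: vnorm_cong)
    also have "\<dots> = ((vnorm n (?B w))^2 + (vnorm n (?C w))^2) + ((vnorm n (?B w2))^2 + (vnorm n (?C w2))^2)
        + (cmod t)^2 * ((vnorm n w)^2 + (vnorm n w2)^2)"
      using cross vnorm_scale[of n "-1" "?B w2"] by (simp add: vnorm_scale power_mult_distrib algebra_simps)
    also have "\<dots> = ((vnorm m v)^2 + (cmod t)^2) * ((vnorm n w)^2 + (vnorm n w2)^2)"
      using T[of v w] T[of v w2] by (simp add: A_def algebra_simps)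
    also have "(vnorm m v)^2 + (cmod t)^2 = (vnorm (Suc m) v)^2"
      by (simp add: vnorm_power2 t_def)
    also have "(vnorm n w)^2 + (vnorm n w2)^2 = (vnorm (n+n) w)^2"
      by (simp add: split w2_def)
    finally show ?thesis by (simp add: A'_def)
  qed
  moreover have "2 ^ Suc m = n + n" by (simp add: n_def)
  ultimately show ?case by (intro exI[of _ T']) simp
qed

section \<open>Testing an operator on elements of the unit ball\<close>

lemma normMin_leI:
  assumes "\<And>m v. vnorm m v \<le> 1 \<Longrightarrow> opnorm n (\<lambda>j k. \<Sum>i<m. v i * X j k i) \<le> 1"
  shows "normMin n X \<le> 1"
  unfolding normMin_def
proof (rule SUP_least)
  fix m
  let ?S = "{opnorm n (\<lambda>j k. \<Sum>i<m. v i * coef X i j k) | v. (\<Sum>i<m. (cmod (v i))^2) \<le> 1}"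
  have "?S \<noteq> {}" by (auto intro!: exI[of _ "\<lambda>i. 0"])
  then have "Sup ?S \<le> 1"
    by (rule cSup_least) (auto simp: coef_def vnorm_le_1_iff assms)
  then show "ereal (Sup ?S) \<le> 1" by simp
qed

lemma tnorm_le_cbnorm:
  assumes "0 \<le> \<theta>" "\<theta> \<le> 1" and "Mn_l2 n X" "normMin n X \<le> 1"
  shows "ereal (tnorm m n (\<lambda>j k. u (X j k))) \<le> cbnorm \<theta> u"
  unfolding cbnorm_def
  by (rule SUP_upper2[of n], simp, rule SUP_upper2[of X])
    (use assms tnorm_le_normRtheta in auto)

text \<open>The 0 x 0 matrix lies in the unit ball, and its image has \<open>tnorm\<close> equal to
  0.\<close>

lemma cbnorm_nonneg:
  assumes "0 \<le> \<theta>" "\<theta> \<le> 1"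
  shows "0 \<le> cbnorm \<theta> u"
proof -
  have "normMin 0 (\<lambda>j k i. 0) \<le> 1" by (rule normMin_leI) simp
  then show ?thesis
    using tnorm_le_cbnorm[OF assms, of 0 "\<lambda>j k i. 0" 0 u] by (simp add: Mn_l2_def zero_ereal_def)
qed

text \<open>The test element has the anticommuting matrices as its first \<open>m\<close>
  coordinates. The i-th coordinate of its image is their combination with coefficients from row i of
  \<open>u\<close>, so \<open>tnorm\<close> squared adds up half the squared row norms.\<close>

lemma column_sums_le_cbnorm:
  assumes \<theta>: "0 \<le> \<theta>" "\<theta> \<le> 1" and u: "is_operator u" and K: "cbnorm \<theta> u \<le> ereal K" "0 \<le> K"
  shows "(\<Sum>l<m. (vnorm M (u (basis l)))^2) \<le> 2 * K^2"
proof -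
  define n :: nat where "n = 2^m"
  obtain T :: "nat \<Rightarrow> cmat" where T: "\<And>v w.
     (vnorm n (mv n (\<lambda>j k. \<Sum>i<m. v i * T i j k) w))^2
     + (vnorm n (mv n (\<lambda>j k. cnj (\<Sum>i<m. v i * T i k j)) w))^2
     = (vnorm m v)^2 * (vnorm n w)^2"
    using anticommuting_matrices[of m] unfolding n_def by blast
  define X where "X j k = trunc m (\<lambda>i. T i j k)" for j k
  \<comment> \<open>Summing the anticommutation identity over the basis vectors gives tr A* A + tr A
    A* = n |v|^2. The two traces are equal, so each is half of this; here the constant 2
    arises.\<close>
  have frob: "(\<Sum>j<n. \<Sum>k<n. (cmod (\<Sum>i<m. v i * T i j k))^2) = n * (vnorm m v)^2 / 2" for v
  proof -
    let ?F = "\<Sum>j<n. \<Sum>k<n. (cmod (\<Sum>i<m. v i * T i j k))^2"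
    have "(\<Sum>j<n. (cmod (\<Sum>i<m. v i * T i j k))^2) + (\<Sum>j<n. (cmod (\<Sum>i<m. v i * T i k j))^2)
        = (vnorm m v)^2" if "k < n" for k
      using T[of v "basis k"] that
      by (simp add: vnorm_power2[of n] vnorm_basis mv_basis del: cnj_sum)
    then have "(\<Sum>k<n. (\<Sum>j<n. (cmod (\<Sum>i<m. v i * T i j k))^2) + (\<Sum>j<n. (cmod (\<Sum>i<m. v i * T i k j))^2))
        = n * (vnorm m v)^2"
      by simp
    moreover have "(\<Sum>k<n. \<Sum>j<n. (cmod (\<Sum>i<m. v i * T i j k))^2) = ?F"
      by (rule sum.swap)
    ultimately show ?thesis by (simp add: sum.distrib)
  qed
  have "normMin n X \<le> 1"
  proof (rule normMin_leI, rule opnorm_le)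
    fix m' v w assume v: "vnorm m' v \<le> 1" and w: "vnorm n w \<le> 1"
    \<comment> \<open>Combinations of any length \<open>m'\<close> must be tested although
      \<open>X\<close> stops at \<open>m\<close>; cutting \<open>v\<close> or padding it by zeros
      turns them into combinations of length \<open>m\<close>.\<close>
    let ?v = "\<lambda>i. if i \<in> {..<m'} then v i else 0"
    have "(\<Sum>i<m'. v i * X j k i) = (\<Sum>i<m. ?v i * T i j k)" for j k
    proof -
      have "(\<Sum>i<m'. v i * X j k i) = (\<Sum>i<m'. if i \<in> {..<m} then v i * T i j k else 0)"
        by (intro sum.cong) (auto simp: X_def trunc_def)
      also have "\<dots> = (\<Sum>i\<in>{..<m} \<inter> {..<m'}. v i * T i j k)"
        by (subst Int_commute) (simp add: sum.inter_restrict)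
      also have "\<dots> = (\<Sum>i<m. if i \<in> {..<m'} then v i * T i j k else 0)"
        by (simp add: sum.inter_restrict)
      finally show ?thesis by (simp add: if_distrib[of "\<lambda>x. x * _"] cong: if_cong)
    qed
    \<comment> \<open>Dropping the nonnegative adjoint term of the identity leaves the contraction
      bound.\<close>
    then have "(vnorm n (mv n (\<lambda>j k. \<Sum>i<m'. v i * X j k i) w))^2 \<le> (vnorm m ?v)^2 * (vnorm n w)^2"
      unfolding T[symmetric] by simp
    also have "(vnorm m ?v)^2 = (\<Sum>i\<in>{..<m} \<inter> {..<m'}. (cmod (v i))^2)"
      unfolding vnorm_power2 by (simp add: sum.inter_restrict if_distrib[of cmod] if_distrib[of "\<lambda>x. x^2"] cong: if_cong)
    also have "\<dots> \<le> (vnorm m' v)^2"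
      unfolding vnorm_power2 by (rule sum_mono2) auto
    finally have "(vnorm n (mv n (\<lambda>j k. \<Sum>i<m'. v i * X j k i) w))^2 \<le> (vnorm m' v)^2 * (vnorm n w)^2"
      by (simp add: mult_right_mono)
    also have "\<dots> \<le> 1 * 1"
      by (intro mult_mono power_le_one v w) auto
    finally show "vnorm n (mv n (\<lambda>j k. \<Sum>i<m'. v i * X j k i) w) \<le> 1"
      by (simp add: power_le_one_iff)
  qed
  moreover have "Mn_l2 n X" by (simp add: Mn_l2_def X_def)
  ultimately have "ereal (tnorm M n (\<lambda>j k. u (X j k))) \<le> ereal K"
    using tnorm_le_cbnorm[OF \<theta>] K order_trans by blast
  then have "(tnorm M n (\<lambda>j k. u (X j k)))^2 \<le> K^2"
    by (intro power_mono) auto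
  moreover have "(tnorm M n (\<lambda>j k. u (X j k)))^2 = (\<Sum>i<M. (vnorm m (\<lambda>l. u (basis l) i))^2 / 2)"
    unfolding tnorm_power2 X_def is_operator_trunc[OF u] frob sum_divide_distrib
    by (simp add: n_def)
  moreover have "(\<Sum>i<M. (vnorm m (\<lambda>l. u (basis l) i))^2) = (\<Sum>l<m. (vnorm M (u (basis l)))^2)"
    unfolding vnorm_power2 by (rule sum.swap)
  ultimately show ?thesis by (simp flip: sum_divide_distrib)
qed

text \<open>In \<open>column_sums_le_cbnorm\<close> first the number M of rows tends to infinity for
  a fixed number of columns, then the partial sums over columns are bounded uniformly.\<close>

lemma hs_le_cbnorm:
  assumes \<theta>: "0 \<le> \<theta>" "\<theta> \<le> 1" and u: "is_operator u" and K: "cbnorm \<theta> u \<le> ereal K" "0 \<le> K"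
  shows "summable (\<lambda>l. (hnorm (u (basis l)))^2)" and "hs_norm u \<le> sqrt 2 * K"
proof -
  have col: "u (basis l) \<in> l2" for l
    by (rule is_operator_l2[OF u basis_l2])
  have le: "(\<Sum>l<m. (hnorm (u (basis l)))^2) \<le> 2 * K^2" for m
  proof (rule tendsto_upperbound)
    have "(\<lambda>M. (vnorm M (u (basis l)))^2) \<longlonglongrightarrow> (hnorm (u (basis l)))^2" for l
      unfolding vnorm_power2 hnorm_power2[OF col] by (intro summable_LIMSEQ l2_summable col)
    then show "(\<lambda>M. \<Sum>l<m. (vnorm M (u (basis l)))^2) \<longlonglongrightarrow> (\<Sum>l<m. (hnorm (u (basis l)))^2)"
      by (intro tendsto_sum)
  qed (auto intro!: always_eventually column_sums_le_cbnorm[OF \<theta> u K])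
  show sm: "summable (\<lambda>l. (hnorm (u (basis l)))^2)"
    by (rule summableI_nonneg_bounded[OF _ le]) simp
  have "hs_norm u \<le> sqrt (2 * K^2)"
    unfolding hs_norm_def by (intro real_sqrt_le_mono suminf_le_const sm le)
  then show "hs_norm u \<le> sqrt 2 * K"
    using K by (simp add: real_sqrt_mult)
qed

text \<open>For 1 x 1 matrices the minimal norm is at most the Hilbert space norm and
  \<open>tnorm\<close> is the truncated vector norm, so a normalized vector serves as a test
  element.\<close>

lemma bounded_op_if_cbnorm:
  assumes \<theta>: "0 \<le> \<theta>" "\<theta> \<le> 1" and u: "is_operator u" and K: "cbnorm \<theta> u \<le> ereal K"
  shows "bounded_op u"
  unfolding bounded_op_def
proof (intro exI ballI)
  fix x assume x: "x \<in> l2"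
  show "hnorm (u x) \<le> K * hnorm x"
  proof (cases "hnorm x = 0")
    case True
    then have "x = (\<lambda>i. 0 * x i)" using cmod_le_hnorm[OF x] by auto
    then have "u x = (\<lambda>i. 0)" using is_operator_scale[OF u x, of 0] by simp
    then show ?thesis using True by (simp add: hnorm_def)
  next
    case False
    then have pos: "0 < hnorm x" using hnorm_nonneg[OF x] by linarith
    define c where "c = complex_of_real (inverse (hnorm x))"
    have c: "cmod c = inverse (hnorm x)" using pos by (simp add: c_def norm_inverse)
    define y where "y = (\<lambda>i. c * x i)"
    have y: "y \<in> l2"
      using summable_mult[OF l2_summable[OF x], of "(cmod c)^2"]
      by (simp add: l2_def y_def norm_mult power_mult_distrib)
    have vy: "vnorm m y \<le> 1" for m
      using vnorm_le_hnorm[OF x, of m] pos by (simp add: y_def vnorm_scale c field_simps)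
    have "normMin 1 (\<lambda>j k. y) \<le> 1"
    proof (rule normMin_leI)
      fix m v assume v: "vnorm m v \<le> 1"
      \<comment> \<open>The double conjugation brings the bilinear sum into the form required by
        \<open>cmod_inner_le\<close>.\<close>
      have "opnorm 1 (\<lambda>j k. \<Sum>i<m. v i * y i) \<le> cmod (\<Sum>i<m. v i * cnj (cnj (y i)))"
        using opnorm_le_entries[of 1 "\<lambda>j k. \<Sum>i<m. v i * y i"] by simp
      also have "\<dots> \<le> vnorm m v * vnorm m (\<lambda>i. cnj (y i))"
        by (rule cmod_inner_le)
      also have "vnorm m (\<lambda>i. cnj (y i)) = vnorm m y" by (simp add: vnorm_def)
      also have "vnorm m v * vnorm m y \<le> 1 * 1"
        by (intro mult_mono v vy) auto
      finally show "opnorm 1 (\<lambda>j k. \<Sum>i<m. v i * y i) \<le> 1" by simp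
    qed
    moreover have "Mn_l2 1 (\<lambda>j k. y)" using y by (simp add: Mn_l2_def)
    ultimately have "ereal (tnorm m 1 (\<lambda>j k. u y)) \<le> ereal K" for m
      using tnorm_le_cbnorm[OF \<theta>] K order_trans by blast
    moreover have "tnorm m 1 (\<lambda>j k. u y) = vnorm m (u y)" for m
      by (rule power2_eq_imp_eq) (simp_all add: tnorm_power2 vnorm_power2)
    ultimately have "vnorm m (u y) \<le> K" for m by simp
    moreover have "u y = (\<lambda>i. c * u x i)"
      unfolding y_def by (rule is_operator_scale[OF u x])
    ultimately have "vnorm m (u x) \<le> K * hnorm x" for m
      using pos by (simp add: vnorm_scale c field_simps)
    then show ?thesis by (rule hnorm_le) (rule is_operator_l2[OF u x])
  qed
qed

theorem theorem4p2:
  fixes \<theta> :: real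
  assumes "0 \<le> \<theta>" and "\<theta> \<le> 1"
  shows "(\<forall>u. is_operator u \<longrightarrow> (cbnorm \<theta> u < \<infinity> \<longleftrightarrow> hilbert_schmidt u)) \<and>
         (\<exists>c C. 0 < c \<and> 0 < C \<and>
            (\<forall>u. hilbert_schmidt u \<longrightarrow>
                 ereal (c * hs_norm u) \<le> cbnorm \<theta> u \<and> cbnorm \<theta> u \<le> ereal (C * hs_norm u)))"
proof (intro conjI)
  have real: "\<exists>K. cbnorm \<theta> u = ereal K \<and> 0 \<le> K" if "cbnorm \<theta> u < \<infinity>" for u
    using that cbnorm_nonneg[OF assms, of u] by (cases "cbnorm \<theta> u") auto
  have upper: "cbnorm \<theta> u \<le> ereal (hs_norm u)" if "hilbert_schmidt u" for u
    by (rule cbnorm_le_hs_norm[OF assms that])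
  show "\<forall>u. is_operator u \<longrightarrow> (cbnorm \<theta> u < \<infinity> \<longleftrightarrow> hilbert_schmidt u)"
  proof (intro allI impI iffI)
    fix u assume u: "is_operator u"
    show "hilbert_schmidt u" if "cbnorm \<theta> u < \<infinity>"
    proof -
      from real[OF that] obtain K where K: "cbnorm \<theta> u \<le> ereal K" "0 \<le> K" by force
      show ?thesis
        unfolding hilbert_schmidt_def
        using u bounded_op_if_cbnorm[OF assms u K(1)] hs_le_cbnorm(1)[OF assms u K] by simp
    qed
    show "cbnorm \<theta> u < \<infinity>" if "hilbert_schmidt u"
      using upper[OF that] by (rule le_less_trans) simp
  qed
  have lower: "ereal (1 / sqrt 2 * hs_norm u) \<le> cbnorm \<theta> u" if hs: "hilbert_schmidt u" for u
  proof -
    have u: "is_operator u" using hs by (simp add: hilbert_schmidt_def)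
    have "cbnorm \<theta> u < \<infinity>" using upper[OF hs] by (rule le_less_trans) simp
    from real[OF this] obtain K where K: "cbnorm \<theta> u = ereal K" "0 \<le> K" by blast
    then have "hs_norm u \<le> sqrt 2 * K" using hs_le_cbnorm(2)[OF assms u] by simp
    then show ?thesis by (simp add: K field_simps)
  qed
  show "\<exists>c C. 0 < c \<and> 0 < C \<and>
            (\<forall>u. hilbert_schmidt u \<longrightarrow>
                 ereal (c * hs_norm u) \<le> cbnorm \<theta> u \<and> cbnorm \<theta> u \<le> ereal (C * hs_norm u))"
    \<comment> \<open>The lower constant comes from the halved trace of the anticommuting matrices;
      the upper bound holds with constant 1.\<close>
    by (rule exI[of _ "1 / sqrt 2"], rule exI[of _ 1]) (use upper lower in auto)
qed

end
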